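(* Let $p$ be an odd prime, let $\sigma\subset\mathbb{C}_p$ be compact and let $\nu\in\mathbf{L}^*(\sigma)$. For every integer $m\ge0$ and every $\lambda\in\mathbb{C}_p$ with $|\lambda|_p$ sufficiently large, $$\zeta_{p,E}^\nu(1-m,\lambda)=\frac{1}{\omega_v^m(\lambda)}\,E_m^\nu(\lambda),\qquad E_m^\nu(\lambda)=\int_\sigma(\lambda+x)^m\,d\nu(x),$$ where $\zeta_{p,E}^\nu(s,\lambda)=\int_\sigma\langle\lambda+x\rangle^{1-s}\,d\nu(x)$ and $\omega_v^m(\lambda)=\omega_v(\lambda)^m$.
   Context: Notation. $\mathbb{C}_p$ is the completion of an algebraic closure of $\mathbb{Q}_p$, $|p|_p=p^{-1}$, $v_p$ is the additive valuation with $v_p(p)=1$. Fix a compatible system of fractional powers $p^r\in\mathbb{C}_p$, $r\in\mathbb{Q}$ (with $p^{r+r'}=p^rp^{r'}$ and $p^1=p$). For $a\in\mathbb{C}_p^\times$ write $a=p^{v_p(a)}u$ with $|u|_p=1$, let $\hat a=\lim_{n\to\infty}u^{p^{n!}}$ (the root of unity of order prime to $p$ with $|\hat a-u|_p<1$), and put $\omega_v(a)=p^{v_p(a)}\hat a$ and $\langle a\rangle=a/\omega_v(a)$, so $|\langle a\rangle-1|_p<1$. For $s\in\mathbb{Z}_p$, $\langle a\rangle^s=\sum_{n\ge0}\binom{s}{n}(\langle a\rangle-1)^n$. Locally analytic functions and generalized distributions. For compact $\sigma\subset\mathbb{C}_p$ and $r>0$ let $D_a(r)=\{z\in\mathbb{C}_p:|z-a|_p<r\}$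 and $\mathbb{D}_\sigma(r)=\bigcup_{a\in\sigma}D_a(r)$. $B_r(\sigma)$ is the Banach space of functions $f$ on $\mathbb{D}_\sigma(r)$ given by a convergent power series on each $D_a(r)$, $a\in\sigma$, with finite norm $\|f\|_r=\sup_{z\in\mathbb{D}_\sigma(r)}|f(z)|_p$. $\mathbf{L}(\sigma)$, the space of locally analytic functions on $\sigma$, is the union (inductive limit over $r\to0$, functions being identified if they agree on some $\mathbb{D}_\sigma(r')$) of the $B_r(\sigma)$, with the inductive limit topology. $\mathbf{L}^*(\sigma)$ is the space of continuous $\mathbb{C}_p$-linear maps $\nu:\mathbf{L}(\sigma)\to\mathbb{C}_p$ (generalized distributions); one writes $\int_\sigma f\,d\nu=\nu(f)$. For $|\lambda|_p>\max_{x\in\sigma}|x|_p$ the function $x\mapsto\langle\lambda+x\rangle^{1-s}$ belongs to $\mathbf{L}(\sigma)$. *)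

theory Defs
  imports "HOL-Analysis.Analysis" "HOL-Computational_Algebra.Computational_Algebra"
begin

section \<open>The field of \<open>p\<close>-adic complex numbers\<close>

text \<open>
  There is no library type for the completion of an algebraic closure of the \<open>p\<close>-adic numbers.
  It is described here up to isometric isomorphism: a field of characteristic 0 which is a complete
  metric space (type classes), whose distance comes from a multiplicative ultrametric absolute value
  with \<open>\<bar>p\<bar> = 1/p\<close>, and in which the elements algebraic over the \<open>p\<close>-adic numbers
  form an algebraically closed and dense subfield. An ultrametric absolute value with
  \<open>\<bar>p\<bar> = 1/p\<close> is the \<open>p\<close>-adic one on the rationals, so the closure of the rationals is the
  field of \<open>p\<close>-adic numbers. The field enters the locale predicate through the argument
  \<open>TYPE('a)\<close>, which the locale mechanism adds in front of \<open>p\<close>.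
\<close>

definition pabs :: "'a::{metric_space,zero} \<Rightarrow> real" where
  "pabs x = dist x 0"

definition Qp :: "'a::{field_char_0,metric_space} set" where
  "Qp = closure \<rat>"

definition Qp_bar :: "'a::{field_char_0,metric_space} set" where
  "Qp_bar = {x. \<exists>f::'a poly. f \<noteq> 0 \<and> (\<forall>i. coeff f i \<in> Qp) \<and> poly f x = 0}"

locale padic_complex_field =
  fixes p :: nat
  assumes prime_p: "prime p"
    and dist_eq_pabs: "\<And>x y::'a::{field_char_0,complete_space}. dist x y = pabs (x - y)"
    and pabs_mult: "\<And>x y::'a. pabs (x * y) = pabs x * pabs y"
    and pabs_add_le_max: "\<And>x y::'a. pabs (x + y) \<le> max (pabs x) (pabs y)"
    and pabs_p: "pabs (of_nat p :: 'a) = 1 / real p"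
    and Qp_bar_alg_closed:
      "\<And>f::'a poly. degree f > 0 \<Longrightarrow> (\<forall>i. coeff f i \<in> Qp_bar) \<Longrightarrow> \<exists>x\<in>Qp_bar. poly f x = 0"
    and Qp_bar_dense: "closure (Qp_bar :: 'a set) = UNIV"

definition fractional_powers :: "nat \<Rightarrow> (rat \<Rightarrow> 'a::field_char_0) \<Rightarrow> bool" where
  "fractional_powers p ppow \<longleftrightarrow>
     (\<forall>r r'. ppow (r + r') = ppow r * ppow r') \<and> ppow 1 = of_nat p"

section \<open>The characters \<open>\<omega>\<^sub>v\<close> and \<open>\<langle>\<cdot>\<rangle>\<close>\<close>

text \<open>
  The value group of the nonzero elements consists of the rational powers of \<open>p\<close>, so the valuation
  can be taken in the rationals. All notions up to \<open>angle\<close> are meant for nonzero arguments.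
\<close>

definition pval :: "nat \<Rightarrow> 'a::{field_char_0,metric_space} \<Rightarrow> rat" where
  "pval p a = (THE r. pabs a = real p powr (- of_rat r))"

definition unit_part :: "nat \<Rightarrow> (rat \<Rightarrow> 'a::{field_char_0,metric_space}) \<Rightarrow> 'a \<Rightarrow> 'a" where
  "unit_part p ppow a = a / ppow (pval p a)"

definition teich :: "nat \<Rightarrow> (rat \<Rightarrow> 'a::{field_char_0,metric_space}) \<Rightarrow> 'a \<Rightarrow> 'a" where
  "teich p ppow a = lim (\<lambda>n. unit_part p ppow a ^ (p ^ fact n))"

definition omega_v :: "nat \<Rightarrow> (rat \<Rightarrow> 'a::{field_char_0,metric_space}) \<Rightarrow> 'a \<Rightarrow> 'a" where
  "omega_v p ppow a = ppow (pval p a) * teich p ppow a"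

definition angle :: "nat \<Rightarrow> (rat \<Rightarrow> 'a::{field_char_0,metric_space}) \<Rightarrow> 'a \<Rightarrow> 'a" where
  "angle p ppow a = a / omega_v p ppow a"

text \<open>The exponent \<open>s\<close> is meant to be a \<open>p\<close>-adic integer, i.e. an element of \<open>closure \<int>\<close>.\<close>

definition angle_pow :: "nat \<Rightarrow> (rat \<Rightarrow> 'a::{field_char_0,metric_space}) \<Rightarrow> 'a \<Rightarrow> 'a \<Rightarrow> 'a" where
  "angle_pow p ppow a s = (\<Sum>n. (s gchoose n) * (angle p ppow a - 1) ^ n)"

section \<open>Locally analytic functions\<close>

text \<open>
  Functions on a neighbourhood of \<open>\<sigma>\<close> are represented by total functions whose values
  outside that neighbourhood are irrelevant; an element of \<open>LA_germs \<sigma>\<close> is a class of such functions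
  agreeing on some \<open>nbhd \<sigma> r\<close>.
\<close>

definition nbhd :: "'a::metric_space set \<Rightarrow> real \<Rightarrow> 'a set" where
  "nbhd \<sigma> r = (\<Union>a\<in>\<sigma>. ball a r)"

definition LA_space :: "'a::{field_char_0,metric_space} set \<Rightarrow> real \<Rightarrow> ('a \<Rightarrow> 'a) set" where
  "LA_space \<sigma> r = {f. (\<forall>a\<in>\<sigma>. \<exists>c. \<forall>z\<in>ball a r. (\<lambda>n. c n * (z - a) ^ n) sums f z) \<and>
               bdd_above ((\<lambda>z. pabs (f z)) ` nbhd \<sigma> r)}"

text \<open>Inserting 0 makes a difference only for empty \<open>\<sigma>\<close>, where the supremum would be unspecified.\<close>

definition LA_norm :: "'a::{field_char_0,metric_space} set \<Rightarrow> real \<Rightarrow> ('a \<Rightarrow> 'a) \<Rightarrow> real" where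
  "LA_norm \<sigma> r f = Sup (insert 0 ((\<lambda>z. pabs (f z)) ` nbhd \<sigma> r))"

definition loc_an :: "'a::{field_char_0,metric_space} set \<Rightarrow> ('a \<Rightarrow> 'a) set" where
  "loc_an \<sigma> = (\<Union>r\<in>{0<..}. LA_space \<sigma> r)"

definition germ :: "'a::metric_space set \<Rightarrow> ('a \<Rightarrow> 'a) \<Rightarrow> ('a \<Rightarrow> 'a) set" where
  "germ \<sigma> f = {g. \<exists>r>0. \<forall>z\<in>nbhd \<sigma> r. g z = f z}"

definition LA_germs :: "'a::{field_char_0,metric_space} set \<Rightarrow> ('a \<Rightarrow> 'a) set set" where
  "LA_germs \<sigma> = germ \<sigma> ` loc_an \<sigma>"

text \<open>
  The inductive limit topology is the finest locally convex topology for which all the maps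
  \<open>LA_space \<sigma> r \<rightarrow> LA_germs \<sigma>\<close> are continuous. Its basic neighbourhoods of 0 are the submodules over the ring
  of integers whose preimage in every \<open>LA_space \<sigma> r\<close> is a neighbourhood of 0.
\<close>

definition L_lattice :: "'a::{field_char_0,metric_space} set \<Rightarrow> ('a \<Rightarrow> 'a) set set \<Rightarrow> bool" where
  "L_lattice \<sigma> V \<longleftrightarrow> V \<subseteq> LA_germs \<sigma> \<and>
     (\<forall>f\<in>loc_an \<sigma>. \<forall>g\<in>loc_an \<sigma>. \<forall>c d. germ \<sigma> f \<in> V \<longrightarrow> germ \<sigma> g \<in> V \<longrightarrow>
        pabs c \<le> 1 \<longrightarrow> pabs d \<le> 1 \<longrightarrow> germ \<sigma> (\<lambda>z. c * f z + d * g z) \<in> V) \<and>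
     (\<forall>r>0. \<exists>\<epsilon>>0. \<forall>f\<in>LA_space \<sigma> r. LA_norm \<sigma> r f \<le> \<epsilon> \<longrightarrow> germ \<sigma> f \<in> V)"

definition L_open :: "'a::{field_char_0,metric_space} set \<Rightarrow> ('a \<Rightarrow> 'a) set set \<Rightarrow> bool" where
  "L_open \<sigma> W \<longleftrightarrow> W \<subseteq> LA_germs \<sigma> \<and>
     (\<forall>f\<in>loc_an \<sigma>. germ \<sigma> f \<in> W \<longrightarrow>
        (\<exists>V. L_lattice \<sigma> V \<and>
             (\<forall>g\<in>loc_an \<sigma>. germ \<sigma> g \<in> V \<longrightarrow> germ \<sigma> (\<lambda>z. f z + g z) \<in> W)))"

definition L_topology :: "'a::{field_char_0,metric_space} set \<Rightarrow> ('a \<Rightarrow> 'a) set topology" where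
  "L_topology \<sigma> = topology (L_open \<sigma>)"

lemma L_lattice_Int:
  fixes \<sigma> :: "'a::{field_char_0,metric_space} set"
  assumes V: "L_lattice \<sigma> V" and V': "L_lattice \<sigma> V'"
  shows "L_lattice \<sigma> (V \<inter> V')"
  unfolding L_lattice_def
proof (intro conjI allI impI ballI)
  show "V \<inter> V' \<subseteq> LA_germs \<sigma>"
    using V by (auto simp: L_lattice_def)
next
  fix f g :: "'a \<Rightarrow> 'a" and c d :: 'a
  assume "f \<in> loc_an \<sigma>" "g \<in> loc_an \<sigma>" "germ \<sigma> f \<in> V \<inter> V'" "germ \<sigma> g \<in> V \<inter> V'"
    "pabs c \<le> 1" "pabs d \<le> 1"
  then show "germ \<sigma> (\<lambda>z. c * f z + d * g z) \<in> V \<inter> V'"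
    using V V' by (simp add: L_lattice_def)
next
  fix r :: real assume r: "r > 0"
  obtain e where e: "e > 0" "\<forall>f\<in>LA_space \<sigma> r. LA_norm \<sigma> r f \<le> e \<longrightarrow> germ \<sigma> f \<in> V"
    using V r by (auto simp: L_lattice_def)
  obtain e' where e': "e' > 0" "\<forall>f\<in>LA_space \<sigma> r. LA_norm \<sigma> r f \<le> e' \<longrightarrow> germ \<sigma> f \<in> V'"
    using V' r by (auto simp: L_lattice_def)
  show "\<exists>\<epsilon>>0. \<forall>f\<in>LA_space \<sigma> r. LA_norm \<sigma> r f \<le> \<epsilon> \<longrightarrow> germ \<sigma> f \<in> V \<inter> V'"
    by (rule exI[of _ "min e e'"]) (use e e' in simp)
qed

lemma L_openD:
  assumes "L_open \<sigma> W" "f \<in> loc_an \<sigma>" "germ \<sigma> f \<in> W"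
  obtains V where "L_lattice \<sigma> V"
    "\<And>g. g \<in> loc_an \<sigma> \<Longrightarrow> germ \<sigma> g \<in> V \<Longrightarrow> germ \<sigma> (\<lambda>z. f z + g z) \<in> W"
  using assms by (auto simp: L_open_def)

lemma L_openI:
  assumes "W \<subseteq> LA_germs \<sigma>"
    and "\<And>f. f \<in> loc_an \<sigma> \<Longrightarrow> germ \<sigma> f \<in> W \<Longrightarrow> \<exists>V. L_lattice \<sigma> V \<and>
      (\<forall>g\<in>loc_an \<sigma>. germ \<sigma> g \<in> V \<longrightarrow> germ \<sigma> (\<lambda>z. f z + g z) \<in> W)"
  shows "L_open \<sigma> W"
  using assms by (simp add: L_open_def)

lemma istopology_L_open: "istopology (L_open \<sigma>)"
  unfolding istopology_def
proof (intro conjI allI impI)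
  fix S T assume S: "L_open \<sigma> S" and T: "L_open \<sigma> T"
  show "L_open \<sigma> (S \<inter> T)"
  proof (rule L_openI)
    show "S \<inter> T \<subseteq> LA_germs \<sigma>" using S by (auto simp: L_open_def)
    fix f assume f: "f \<in> loc_an \<sigma>" "germ \<sigma> f \<in> S \<inter> T"
    obtain V where V: "L_lattice \<sigma> V"
      "\<And>g. g \<in> loc_an \<sigma> \<Longrightarrow> germ \<sigma> g \<in> V \<Longrightarrow> germ \<sigma> (\<lambda>z. f z + g z) \<in> S"
      using L_openD[OF S f(1)] f(2) by auto
    obtain V' where V': "L_lattice \<sigma> V'"
      "\<And>g. g \<in> loc_an \<sigma> \<Longrightarrow> germ \<sigma> g \<in> V' \<Longrightarrow> germ \<sigma> (\<lambda>z. f z + g z) \<in> T"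
      using L_openD[OF T f(1)] f(2) by auto
    show "\<exists>V. L_lattice \<sigma> V \<and>
            (\<forall>g\<in>loc_an \<sigma>. germ \<sigma> g \<in> V \<longrightarrow> germ \<sigma> (\<lambda>z. f z + g z) \<in> S \<inter> T)"
      by (rule exI[of _ "V \<inter> V'"]) (simp add: V V' L_lattice_Int)
  qed
next
  fix K assume K: "\<forall>S\<in>K. L_open \<sigma> S"
  show "L_open \<sigma> (\<Union>K)"
  proof (rule L_openI)
    show "\<Union>K \<subseteq> LA_germs \<sigma>" using K by (auto simp: L_open_def)
    fix f assume f: "f \<in> loc_an \<sigma>" "germ \<sigma> f \<in> \<Union>K"
    then obtain S where S: "S \<in> K" "germ \<sigma> f \<in> S" by auto
    obtain V where V: "L_lattice \<sigma> V"
      "\<And>g. g \<in> loc_an \<sigma> \<Longrightarrow> germ \<sigma> g \<in> V \<Longrightarrow> germ \<sigma> (\<lambda>z. f z + g z) \<in> S"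
      using L_openD[OF K[rule_format, OF S(1)] f(1) S(2)] by auto
    show "\<exists>V. L_lattice \<sigma> V \<and>
            (\<forall>g\<in>loc_an \<sigma>. germ \<sigma> g \<in> V \<longrightarrow> germ \<sigma> (\<lambda>z. f z + g z) \<in> \<Union>K)"
      by (rule exI[of _ V]) (use V S(1) in auto)
  qed
qed

lemma openin_L_topology: "openin (L_topology \<sigma>) = L_open \<sigma>"
  by (simp add: L_topology_def istopology_L_open)

section \<open>Generalized distributions and the zeta function\<close>

definition L_dual :: "'a::{field_char_0,metric_space} set \<Rightarrow> (('a \<Rightarrow> 'a) set \<Rightarrow> 'a) set" where
  "L_dual \<sigma> = {\<nu>.
     (\<forall>f\<in>loc_an \<sigma>. \<forall>g\<in>loc_an \<sigma>. \<nu> (germ \<sigma> (\<lambda>z. f z + g z)) = \<nu> (germ \<sigma> f) + \<nu> (germ \<sigma> g)) \<and>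
     (\<forall>c. \<forall>f\<in>loc_an \<sigma>. \<nu> (germ \<sigma> (\<lambda>z. c * f z)) = c * \<nu> (germ \<sigma> f)) \<and>
     continuous_map (L_topology \<sigma>) euclidean \<nu>}"

definition integral_L :: "'a::metric_space set \<Rightarrow> (('a \<Rightarrow> 'a) set \<Rightarrow> 'a) \<Rightarrow> ('a \<Rightarrow> 'a) \<Rightarrow> 'a" where
  "integral_L \<sigma> \<nu> f = \<nu> (germ \<sigma> f)"

definition zeta_E :: "nat \<Rightarrow> (rat \<Rightarrow> 'a::{field_char_0,metric_space}) \<Rightarrow> 'a set \<Rightarrow>
    (('a \<Rightarrow> 'a) set \<Rightarrow> 'a) \<Rightarrow> 'a \<Rightarrow> 'a \<Rightarrow> 'a" where
  "zeta_E p ppow \<sigma> \<nu> s l = integral_L \<sigma> \<nu> (\<lambda>x. angle_pow p ppow (l + x) (1 - s))"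

definition Euler_E :: "'a::{field_char_0,metric_space} set \<Rightarrow> (('a \<Rightarrow> 'a) set \<Rightarrow> 'a) \<Rightarrow>
    nat \<Rightarrow> 'a \<Rightarrow> 'a" where
  "Euler_E \<sigma> \<nu> m l = integral_L \<sigma> \<nu> (\<lambda>x. (l + x) ^ m)"

end

theory Submission
  imports Defs
begin

text \<open>
  At \<open>s = 1 - m\<close> the binomial series is finite, so \<open>\<langle>a\<rangle>\<^sup>m\<close> is literally \<open>(a / \<omega>\<^sub>v(a))\<^sup>m\<close>. If
  \<open>\<bar>x\<bar> < \<bar>\<lambda>\<bar>\<close>, then \<open>\<lambda>\<close> and \<open>\<lambda> + x\<close> have the same valuation, and the quotient \<open>z\<close> of their unit
  parts satisfies \<open>\<bar>z - 1\<bar> < 1\<close>, so that \<open>z ^ p ^ N\<close> tends to 1. Hence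
  \<open>\<omega>\<^sub>v(\<lambda> + x) = \<omega>\<^sub>v(\<lambda>)\<close> for all \<open>x\<close> in a bounded neighbourhood of \<open>\<sigma>\<close> once \<open>\<bar>\<lambda>\<bar>\<close> is large, and
  this constant comes out of the integral by linearity of \<open>\<nu>\<close>.
\<close>

section \<open>The rational powers of \<open>p\<close> as a group of real numbers\<close>

definition rat_powers :: "nat \<Rightarrow> real set" where
  "rat_powers p = range (\<lambda>r::rat. real p powr of_rat r)"

lemma rat_powersI: "x = real p powr of_rat r \<Longrightarrow> x \<in> rat_powers p"
  by (simp add: rat_powers_def)

lemma rat_powersE:
  assumes "x \<in> rat_powers p"
  obtains r where "x = real p powr of_rat r"
  using assms by (auto simp: rat_powers_def)

lemma rat_powers_mult: "x \<in> rat_powers p \<Longrightarrow> y \<in> rat_powers p \<Longrightarrow> x * y \<in> rat_powers p"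
  by (elim rat_powersE, rule rat_powersI) (simp add: powr_add[symmetric] of_rat_add[symmetric])

lemma rat_powers_divide: "x \<in> rat_powers p \<Longrightarrow> y \<in> rat_powers p \<Longrightarrow> x / y \<in> rat_powers p"
  by (elim rat_powersE, rule rat_powersI) (simp add: powr_diff[symmetric] of_rat_diff[symmetric])

lemma one_in_rat_powers: "p > 0 \<Longrightarrow> 1 \<in> rat_powers p"
  by (rule rat_powersI[of _ _ 0]) simp

lemma rat_powers_power: "p > 0 \<Longrightarrow> x \<in> rat_powers p \<Longrightarrow> x ^ n \<in> rat_powers p"
  by (induction n) (auto intro: rat_powers_mult one_in_rat_powers)

text \<open>Exponents in the rationals can be divided by \<open>n\<close>, and nonnegative real
  \<open>n\<close>-th roots are unique. This divisibility is what carries the value group from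
  \<open>Qp\<close> to its algebraic closure.\<close>

lemma rat_powers_root:
  assumes "p > 0" "n > 0" "x \<ge> 0" "x ^ n \<in> rat_powers p"
  shows "x \<in> rat_powers p"
proof -
  obtain r where r: "x ^ n = real p powr of_rat r"
    using assms(4) by (elim rat_powersE)
  have "(real p powr of_rat (r / of_nat n)) ^ n = real p powr of_rat r"
    using assms by (simp add: powr_realpow[symmetric] powr_powr of_rat_divide)
  then have "x = real p powr of_rat (r / of_nat n)"
    using r assms by (intro power_eq_imp_eq_base[of x n]) simp_all
  then show ?thesis by (rule rat_powersI)
qed

section \<open>Germs, limits and the terminating binomial series\<close>

lemma germ_cong:
  assumes "r > 0" "\<And>z. z \<in> nbhd \<sigma> r \<Longrightarrow> f z = g z"
  shows "germ \<sigma> f = germ \<sigma> g"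
proof -
  have *: "germ \<sigma> f \<subseteq> germ \<sigma> g" if fg: "\<And>z. z \<in> nbhd \<sigma> r \<Longrightarrow> f z = g z" for f g
  proof
    fix h assume "h \<in> germ \<sigma> f"
    then obtain r' where r': "r' > 0" "\<And>z. z \<in> nbhd \<sigma> r' \<Longrightarrow> h z = f z"
      by (auto simp: germ_def)
    have "h z = g z" if "z \<in> nbhd \<sigma> (min r r')" for z
    proof -
      have "z \<in> nbhd \<sigma> r" "z \<in> nbhd \<sigma> r'"
        using that by (auto simp: nbhd_def)
      then show ?thesis using r'(2) fg by simp
    qed
    then show "h \<in> germ \<sigma> g"
      using r'(1) assms(1) by (auto simp: germ_def intro!: exI[of _ "min r r'"])
  qed
  show ?thesis using *[of f g] *[of g f] assms(2) by auto
qed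

text \<open>Convergence is not assumed: \<open>X\<close> and \<open>Y\<close> converge to exactly
  the same points, so the descriptions that define \<open>lim\<close> coincide in every
  case.\<close>

lemma lim_eqI_dist:
  fixes X Y :: "nat \<Rightarrow> 'a::metric_space"
  assumes "(\<lambda>n. dist (X n) (Y n)) \<longlonglongrightarrow> 0"
  shows "lim X = lim Y"
proof -
  have *: "Y \<longlonglongrightarrow> L" if "X \<longlonglongrightarrow> L" "(\<lambda>n. dist (X n) (Y n)) \<longlonglongrightarrow> 0"
    for L and X Y :: "nat \<Rightarrow> 'a"
  proof -
    have "(\<lambda>n. dist (X n) (Y n) + dist (X n) L) \<longlonglongrightarrow> 0 + 0"
      using that tendsto_dist_iff[of X L] by (intro tendsto_add) auto
    then have "(\<lambda>n. dist (X n) (Y n) + dist (X n) L) \<longlonglongrightarrow> 0"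
      by simp
    then have "(\<lambda>n. dist (Y n) L) \<longlonglongrightarrow> 0"
      by (rule Lim_null_comparison[rotated]) (simp add: dist_triangle3)
    then show ?thesis using tendsto_dist_iff by blast
  qed
  have "X \<longlonglongrightarrow> L \<longleftrightarrow> Y \<longlonglongrightarrow> L" for L
    using *[of X L Y] *[of Y L X] assms by (auto simp: dist_commute)
  then show ?thesis by (simp add: lim_def)
qed

lemma angle_pow_of_nat:
  fixes ppow :: "rat \<Rightarrow> 'a::{field_char_0,metric_space}"
  shows "angle_pow p ppow a (of_nat m) = angle p ppow a ^ m"
proof -
  let ?t = "angle p ppow a - 1"
  have "angle_pow p ppow a (of_nat m) = (\<Sum>n\<le>m. (of_nat m gchoose n) * ?t ^ n)"
    unfolding angle_pow_def
    \<comment> \<open>At a natural number \<open>m\<close>, \<open>gchoose\<close> is the ordinary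
      binomial coefficient, which vanishes for \<open>n > m\<close>.\<close>
    by (rule suminf_finite) (auto simp: binomial_gbinomial[symmetric])
  also have "\<dots> = (?t + 1) ^ m"
    unfolding binomial_ring by (simp add: binomial_gbinomial[symmetric] mult_ac)
  finally show ?thesis by simp
qed

context padic_complex_field
begin

section \<open>Elementary ultrametric estimates\<close>

lemma p_gt_1: "real p > 1"
  using prime_gt_1_nat[OF prime_p] by simp

lemma p_gt_0: "p > 0"
  using prime_gt_0_nat[OF prime_p] .

lemma pabs_nonneg: "pabs (x::'a) \<ge> 0"
  by (simp add: pabs_def)

lemma pabs_eq_0_iff: "pabs (x::'a) = 0 \<longleftrightarrow> x = 0"
  by (simp add: pabs_def)

lemma pabs_0: "pabs (0::'a) = 0"
  by (simp add: pabs_def)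

lemma pabs_1: "pabs (1::'a) = 1"
  using pabs_mult[of 1 1] pabs_eq_0_iff[of 1] by simp

lemma pabs_minus: "pabs (- x :: 'a) = pabs x"
  using dist_eq_pabs[of 0 x] by (simp add: pabs_def dist_commute)

lemma pabs_diff_le_max: "pabs (x - y :: 'a) \<le> max (pabs x) (pabs y)"
  using pabs_add_le_max[of x "- y"] by (simp add: pabs_minus)

lemma pabs_power: "pabs (x ^ n :: 'a) = pabs x ^ n"
  by (induction n) (simp_all add: pabs_1 pabs_mult)

lemma pabs_divide: "pabs (x / y :: 'a) = pabs x / pabs y"
  using pabs_mult[of "x / y" y] by (cases "y = 0") (auto simp: pabs_0 pabs_eq_0_iff)

text \<open>The larger term dominates: writing \<open>x\<close> as \<open>(x + y) - y\<close> bounds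
  \<open>pabs x\<close> by a maximum that \<open>pabs y\<close> is too small to attain.\<close>

lemma pabs_add_eq:
  assumes "pabs (y::'a) < pabs x"
  shows "pabs (x + y) = pabs x"
proof -
  have "pabs x \<le> max (pabs (x + y)) (pabs y)"
    using pabs_diff_le_max[of "x + y" y] by simp
  then show ?thesis using pabs_add_le_max[of x y] assms by linarith
qed

lemma pabs_sum_le:
  assumes "C \<ge> 0" "\<And>i. i \<in> S \<Longrightarrow> pabs (f i :: 'a) \<le> C"
  shows "pabs (sum f S) \<le> C"
  using assms(2)
proof (induction S rule: infinite_finite_induct)
  case (insert i S)
  then show ?case
    using pabs_add_le_max[of "f i" "sum f S"] by (simp, smt (verit) insert_iff)
\<comment> \<open>Empty sums and sums over infinite sets are 0, which is where
  \<open>C \<ge> 0\<close> enters.\<close>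
qed (simp_all add: pabs_0 assms(1))

section \<open>The value group, from integers up to the whole field\<close>

lemma pabs_of_int_le_1: "pabs (of_int n :: 'a) \<le> 1"
proof -
  have *: "pabs (of_nat k :: 'a) \<le> 1" for k
  proof (induction k)
    case (Suc k)
    then show ?case using pabs_add_le_max[of 1 "of_nat k"] by (simp add: pabs_1)
  qed (simp add: pabs_0)
  show ?thesis
    by (cases n rule: int_cases2) (simp_all add: * pabs_minus)
qed

text \<open>Bezout writes 1 as \<open>x * p + y * n\<close> with integers \<open>x\<close>,
  \<open>y\<close> of absolute value at most 1; were \<open>pabs n < 1\<close>, both terms and hence
  1 would have absolute value below 1.\<close>

lemma pabs_of_nat_coprime:
  assumes "\<not> p dvd n"
  shows "pabs (of_nat n :: 'a) = 1"
proof (rule ccontr)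
  assume "pabs (of_nat n :: 'a) \<noteq> 1"
  then have lt: "pabs (of_nat n :: 'a) < 1"
    using pabs_of_int_le_1[of "int n"] by simp
  have "coprime (int p) (int n)"
    using assms prime_p by (simp add: prime_imp_coprime)
  then obtain x y where xy: "x * int p + y * int n = 1"
    using bezout_int[of "int p" "int n"] by (metis coprime_iff_gcd_eq_1)
  have "of_int x * of_nat p + of_int y * of_nat n = (1::'a)"
    using arg_cong[OF xy, of "of_int :: int \<Rightarrow> 'a"] by simp
  then have "1 \<le> max (pabs (of_int x * of_nat p :: 'a)) (pabs (of_int y * of_nat n :: 'a))"
    using pabs_add_le_max[of "of_int x * of_nat p" "of_int y * of_nat n"] by (simp add: pabs_1)
  moreover have "pabs (of_int x * of_nat p :: 'a) < 1"
    using pabs_of_int_le_1[of x] p_gt_1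
    by (simp add: pabs_mult pabs_p divide_simps)
  moreover have "pabs (of_int y * of_nat n :: 'a) < 1"
    using mult_left_le_one_le[OF pabs_nonneg[of "of_nat n"] pabs_nonneg pabs_of_int_le_1, of y] lt
    by (simp add: pabs_mult)
  ultimately show False by simp
qed

text \<open>Factors \<open>p\<close> are split off one at a time, each contributing exponent -1,
  until a cofactor of absolute value 1 remains.\<close>

lemma pabs_of_nat_in_rat_powers:
  assumes "n > 0"
  shows "pabs (of_nat n :: 'a) \<in> rat_powers p"
  using assms
proof (induction n rule: less_induct)
  case (less n)
  show ?case
  proof (cases "p dvd n")
    case True
    then obtain k where k: "n = p * k" by (elim dvdE)
    have "pabs (of_nat k :: 'a) \<in> rat_powers p"
      using less k prime_gt_1_nat[OF prime_p] by (intro less.IH) auto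
    moreover have "pabs (of_nat p :: 'a) \<in> rat_powers p"
      using p_gt_0 by (intro rat_powersI[of _ _ "-1"]) (simp add: pabs_p powr_minus_divide)
    ultimately show ?thesis
      by (simp add: k pabs_mult rat_powers_mult)
  next
    case False
    then show ?thesis by (simp add: pabs_of_nat_coprime one_in_rat_powers p_gt_0)
  qed
qed

lemma pabs_Rats_in_rat_powers:
  assumes "q \<in> \<rat>" "q \<noteq> (0::'a)"
  shows "pabs q \<in> rat_powers p"
proof -
  have int: "pabs (of_int n :: 'a) \<in> rat_powers p" if "n \<noteq> 0" for n
    using that pabs_of_nat_in_rat_powers[of "nat \<bar>n\<bar>"]
    by (cases n rule: int_cases2) (simp_all add: pabs_minus)
  obtain a b where ab: "b > 0" "q = of_int a / of_int b"
    using assms(1) by (cases rule: Rats_cases') auto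
  then have "a \<noteq> 0" using assms(2) by auto
  then show ?thesis using ab int[of a] int[of b] by (simp add: pabs_divide rat_powers_divide)
qed

text \<open>Ultrametric absolute values are locally constant away from 0.\<close>

lemma closure_obtain_pabs_eq:
  assumes "x \<in> closure S" "x \<noteq> (0::'a)"
  obtains y where "y \<in> S" "pabs y = pabs x" "y \<noteq> 0"
proof -
  have pos: "pabs x > 0" using assms(2) pabs_nonneg[of x] pabs_eq_0_iff[of x] by linarith
  then obtain y where y: "y \<in> S" "dist y x < pabs x"
    using assms(1) by (auto simp: closure_approachable)
  then have "pabs y = pabs x"
    using pabs_add_eq[of "y - x" x] by (simp add: dist_eq_pabs)
  then show ?thesis using that[of y] y(1) pos pabs_0 by fastforce
qed

lemma pabs_Qp_in_rat_powers:
  assumes "c \<in> Qp" "c \<noteq> (0::'a)"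
  shows "pabs c \<in> rat_powers p"
  using assms closure_obtain_pabs_eq[of c \<rat>] pabs_Rats_in_rat_powers
  unfolding Qp_def by metis

text \<open>No cancellation is possible: the sum of the earlier terms has the absolute value of one
  of them, hence differs in size from the new term, and the larger of the two wins.\<close>

lemma pabs_sum_inj:
  assumes "finite S" "S \<noteq> {}" "inj_on (\<lambda>i. pabs (T i :: 'a)) S"
  shows "\<exists>i\<in>S. pabs (sum T S) = pabs (T i)"
  using assms
proof (induction S rule: finite_ne_induct)
  case (insert j S)
  then obtain i where i: "i \<in> S" "pabs (sum T S) = pabs (T i)" by auto
  have "pabs (T j) \<noteq> pabs (T i)" using insert i by (auto simp: inj_on_def)
  then consider "pabs (sum T S) < pabs (T j)" | "pabs (T j) < pabs (sum T S)"
    using i by linarith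
  then show ?case
  proof cases
    case 1
    then show ?thesis using insert pabs_add_eq by auto
  next
    case 2
    then have "pabs (T j + sum T S) = pabs (T i)"
      using pabs_add_eq[OF 2] i by (simp add: add.commute)
    then show ?thesis using insert i by auto
  qed
qed simp

text \<open>In a vanishing sum two nonzero terms must have the same absolute value.\<close>

lemma pabs_Qp_bar_in_rat_powers:
  assumes "b \<in> Qp_bar" "b \<noteq> (0::'a)"
  shows "pabs b \<in> rat_powers p"
proof -
  obtain f :: "'a poly" where f: "f \<noteq> 0" "\<And>i. coeff f i \<in> Qp" "poly f b = 0"
    using assms(1) by (auto simp: Qp_bar_def)
  define S where "S = {i. i \<le> degree f \<and> coeff f i \<noteq> 0}"
  define T where "T i = coeff f i * b ^ i" for i
  have S: "finite S" "S \<noteq> {}"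
    using f(1) by (auto simp: S_def intro!: exI[of _ "degree f"])
  have "sum T S = (\<Sum>i\<le>degree f. T i)"
    by (rule sum.mono_neutral_left) (auto simp: S_def T_def)
  then have "sum T S = 0"
    using f(3) by (simp add: poly_altdef T_def)
  moreover have "T i \<noteq> 0" if "i \<in> S" for i
    using that assms(2) by (simp add: S_def T_def)
  ultimately have "\<not> inj_on (\<lambda>i. pabs (T i)) S"
    using pabs_sum_inj[OF S, of T] by (auto simp: pabs_0 pabs_eq_0_iff dest: sym)
  then obtain i j where ij: "i \<in> S" "j \<in> S" "i < j" "pabs (T i) = pabs (T j)"
    unfolding inj_on_def by (metis nat_neq_iff)
  have b: "pabs b > 0" using assms(2) pabs_nonneg[of b] pabs_eq_0_iff[of b] by linarith
  have c: "coeff f i \<noteq> 0" "coeff f j \<noteq> 0" using ij by (auto simp: S_def)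
  \<comment> \<open>Splitting \<open>j\<close> as \<open>i + (j - i)\<close> lets
    \<open>pabs b ^ i\<close> cancel, so a positive power of \<open>pabs b\<close> becomes a
    quotient of values from \<open>Qp\<close>.\<close>
  have "pabs (coeff f i) * pabs b ^ i = pabs (coeff f j) * pabs b ^ (i + (j - i))"
    using ij by (simp add: T_def pabs_mult pabs_power)
  then have "pabs b ^ (j - i) = pabs (coeff f i) / pabs (coeff f j)"
    using b c pabs_eq_0_iff[of "coeff f j"]
    by (auto simp: power_add eq_divide_eq pabs_0 mult.commute[of "pabs b ^ (j - i)"])
  also have "\<dots> \<in> rat_powers p"
    using c f(2) by (intro rat_powers_divide pabs_Qp_in_rat_powers)
  finally show ?thesis
    by (rule rat_powers_root[of p "j - i", rotated 3])
      (use ij in \<open>simp_all add: pabs_nonneg p_gt_0\<close>)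
qed

text \<open>Completion adds no new values: by density some algebraic element is close enough to
  \<open>a\<close> to have the same absolute value.\<close>

lemma pabs_in_rat_powers:
  assumes "a \<noteq> (0::'a)"
  shows "pabs a \<in> rat_powers p"
  using closure_obtain_pabs_eq[of a Qp_bar] pabs_Qp_bar_in_rat_powers assms Qp_bar_dense
  by (metis UNIV_I)

text \<open>Justifies the definite description in \<open>pval\<close>: existence is the computation
  of the value group, uniqueness is injectivity of real powers of \<open>p > 1\<close>.\<close>

lemma pabs_eq_powr_pval:
  assumes "a \<noteq> (0::'a)"
  shows "pabs a = real p powr (- of_rat (pval p a))"
proof -
  obtain r where "pabs a = real p powr of_rat r"
    using pabs_in_rat_powers[OF assms] by (elim rat_powersE)
  then have r: "pabs a = real p powr (- of_rat (- r))"
    by (simp add: of_rat_minus)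
  have "s = - r" if "pabs a = real p powr (- of_rat s)" for s
    using powr_inj[of "real p" "- of_rat s" "- of_rat (- r)"] p_gt_1 that r
    by (metis neg_equal_iff_equal of_rat_eq_iff less_numeral_extra(3,4) less_trans zero_less_one)
  then show ?thesis
    unfolding pval_def using r by (rule theI[where a="- r", rotated])
qed

section \<open>Convergence of \<open>z ^ (p ^ N)\<close> to 1 for \<open>z\<close> near 1\<close>

lemma pabs_power_minus_1_le:
  assumes "pabs (z::'a) \<le> 1"
  shows "pabs (z ^ i - 1) \<le> pabs (z - 1)"
proof (induction i)
  case (Suc i)
  have "z ^ Suc i - 1 = z * (z ^ i - 1) + (z - 1)"
    by (simp add: algebra_simps)
  moreover have "pabs (z * (z ^ i - 1)) \<le> pabs (z - 1)"
    using mult_left_le_one_le[OF pabs_nonneg pabs_nonneg assms, of "z ^ i - 1"] Suc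
    by (simp add: pabs_mult)
  ultimately show ?case
    using pabs_add_le_max[of "z * (z ^ i - 1)" "z - 1"] by (metis max.absorb2)
qed (simp add: pabs_0 pabs_nonneg)

text \<open>
  Each summand of \<open>(z\<^sup>p - 1) / (z - 1) = 1 + z + \<dots> + z\<^bsup>p-1\<^esup>\<close> is close to 1, so the sum is close to \<open>p\<close>,
  which is small.
\<close>

lemma pabs_power_p_minus_1_le:
  assumes "pabs (z - 1 :: 'a) \<le> c" "1 / real p \<le> c" "c < 1"
  shows "pabs (z ^ p - 1) \<le> c * pabs (z - 1)"
proof -
  have z: "pabs z \<le> 1"
    using pabs_add_le_max[of 1 "z - 1"] assms by (simp add: pabs_1)
  have c0: "c \<ge> 0" using assms pabs_nonneg order_trans by blast
  have "(\<Sum>i<p. z ^ i) = (\<Sum>i<p. z ^ i - 1) + of_nat p"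
    by (simp add: sum_subtractf)
  moreover have "pabs (\<Sum>i<p. z ^ i - 1) \<le> c"
    using pabs_power_minus_1_le[OF z] assms(1) c0 by (intro pabs_sum_le) (auto intro: order_trans)
  ultimately have "pabs (\<Sum>i<p. z ^ i) \<le> c"
    using pabs_add_le_max[of "\<Sum>i<p. z ^ i - 1" "of_nat p"] assms(2) by (simp add: pabs_p)
  moreover have "z ^ p - 1 = (z - 1) * (\<Sum>i<p. z ^ i)"
    by (rule power_diff_1_eq)
  ultimately show ?thesis
    by (simp add: pabs_mult mult.commute[of "pabs (z - 1)"] mult_right_mono pabs_nonneg)
qed

text \<open>The powers stay within distance \<open>c\<close> of 1, so the one-step estimate applies
  again and each further \<open>p\<close>-th power gains a factor \<open>c\<close>.\<close>

lemma pabs_power_p_power_minus_1_le: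
  assumes "pabs (z - 1 :: 'a) \<le> c" "1 / real p \<le> c" "c < 1"
  shows "pabs (z ^ (p ^ N) - 1) \<le> c ^ N * pabs (z - 1)"
proof (induction N)
  case (Suc N)
  have c0: "c \<ge> 0" using assms pabs_nonneg order_trans by blast
  have "c ^ N * pabs (z - 1) \<le> pabs (z - 1)"
    using c0 assms(3) by (intro mult_left_le_one_le) (simp_all add: pabs_nonneg power_le_one)
  then have "pabs (z ^ (p ^ N) - 1) \<le> c" using Suc assms(1) by linarith
  then have "pabs ((z ^ (p ^ N)) ^ p - 1) \<le> c * pabs (z ^ (p ^ N) - 1)"
    using assms by (intro pabs_power_p_minus_1_le)
  also have "\<dots> \<le> c * (c ^ N * pabs (z - 1))"
    using Suc c0 by (rule mult_left_mono)
  finally show ?case by (simp add: power_mult[symmetric] mult_ac)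
qed simp

lemma power_p_fact_tendsto_1:
  assumes "pabs (z - 1 :: 'a) < 1"
  shows "(\<lambda>n. pabs (z ^ (p ^ fact n) - 1)) \<longlonglongrightarrow> 0"
proof -
  \<comment> \<open>The rate has to dominate both \<open>pabs p\<close> and
    \<open>pabs (z - 1)\<close>; both are below 1.\<close>
  define c where "c = max (1 / real p) (pabs (z - 1))"
  have c: "pabs (z - 1) \<le> c" "1 / real p \<le> c" "c < 1" "c \<ge> 0"
    using assms p_gt_1 by (auto simp: c_def le_max_iff_disj)
  have "pabs (z ^ (p ^ fact n) - 1) \<le> c ^ n" for n
  proof -
    have "pabs (z ^ (p ^ fact n) - 1) \<le> c ^ fact n * pabs (z - 1)"
      by (rule pabs_power_p_power_minus_1_le[OF c(1-3)])
    \<comment> \<open>Since \<open>fact n \<ge> n\<close>, a geometric sequence suffices for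
      comparison.\<close>
    also have "\<dots> \<le> c ^ n * 1"
      using c assms fact_ge_self[of n]
      by (intro mult_mono power_decreasing) (simp_all add: pabs_nonneg)
    finally show ?thesis by simp
  qed
  then show ?thesis
    using c by (intro Lim_null_comparison[OF _ LIMSEQ_realpow_zero[of c]]) (simp_all add: pabs_nonneg)
qed

section \<open>Fractional powers and local constancy of \<open>omega_v\<close>\<close>

context
  fixes ppow :: "rat \<Rightarrow> 'a"
  assumes ppow: "fractional_powers p ppow"
begin

lemma ppow_add: "ppow (r + r') = ppow r * ppow r'"
  using ppow by (simp add: fractional_powers_def)

lemma ppow_1: "ppow 1 = of_nat p"
  using ppow by (simp add: fractional_powers_def)

lemma ppow_0: "ppow 0 = 1"
  using ppow_add[of 0 1] ppow_1 p_gt_0 by simp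

lemma ppow_of_nat_mult: "ppow (of_nat n * r) = ppow r ^ n"
  by (induction n) (simp_all add: ppow_0 ppow_add distrib_right)

lemma pabs_ppow_of_int: "pabs (ppow (of_int k)) = real p powr (- of_int k)"
proof -
  have nat: "pabs (ppow (of_nat n)) = real p powr (- real n)" for n
    using ppow_of_nat_mult[of n 1] p_gt_1
    by (simp add: ppow_1 pabs_power pabs_p powr_minus powr_realpow power_divide divide_inverse
        power_inverse)
  show ?thesis
  proof (cases k rule: int_cases2)
    case (nonneg n)
    then show ?thesis using nat[of n] by simp
  next
    case (nonpos n)
    have "pabs (ppow (- of_nat n)) * real p powr (- real n) = 1"
      using ppow_add[of "- of_nat n" "of_nat n"] nat[of n]
      by (simp add: ppow_0 pabs_1 flip: pabs_mult nat)
    then show ?thesis using nonpos p_gt_1 by (simp add: powr_minus field_simps)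
  qed
qed

text \<open>Raising to the denominator of \<open>r\<close> reduces to integer exponents; nonnegative
  real roots are unique, so the absolute value does not depend on the chosen system
  \<open>ppow\<close>.\<close>

lemma pabs_ppow: "pabs (ppow r) = real p powr (- of_rat r)"
proof -
  obtain a b where ab: "b > 0" "r = of_int a / of_int b"
    by (cases r) (auto simp: Fract_of_int_quotient)
  define n where "n = nat b"
  have n: "n > 0" "of_nat n * r = of_int a" "real n * of_rat r = of_int a"
    using ab by (simp_all add: n_def of_rat_divide)
  have "pabs (ppow r) ^ n = real p powr (- of_int a)"
    using ppow_of_nat_mult[of n r] n pabs_ppow_of_int[of a] by (simp add: pabs_power)
  also have "\<dots> = (real p powr (- of_rat r)) ^ n"
    using p_gt_1 n(3) by (simp add: powr_realpow[symmetric] powr_powr mult.commute)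
  finally show ?thesis
    by (rule power_eq_imp_eq_base[of _ n]) (use n in \<open>simp_all add: pabs_nonneg\<close>)
qed

lemma pabs_unit_part: "a \<noteq> 0 \<Longrightarrow> pabs (unit_part p ppow a) = 1"
  using pabs_ppow[of "pval p a"] pabs_eq_powr_pval[of a] p_gt_1
  by (simp add: unit_part_def pabs_divide)

lemma omega_v_add:
  assumes "pabs x < pabs (l::'a)"
  shows "omega_v p ppow (l + x) = omega_v p ppow l"
proof -
  let ?u = "unit_part p ppow l" and ?u' = "unit_part p ppow (l + x)"
  have l: "l \<noteq> 0" using assms pabs_nonneg[of x] by (auto simp: pabs_0)
  have val: "pval p (l + x) = pval p l"
    using pabs_add_eq[OF assms] by (simp add: pval_def)
  have u: "pabs ?u = 1" using l by (rule pabs_unit_part)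
  define z where "z = (l + x) / l"
  have u': "?u' = ?u * z"
    using l by (simp add: unit_part_def val z_def)
  have "z - 1 = x / l" using l by (simp add: z_def add_divide_distrib)
  then have "pabs (z - 1) < 1"
    using assms pabs_nonneg[of x] by (simp add: pabs_divide)
  then have lim: "(\<lambda>n. pabs (z ^ (p ^ fact n) - 1)) \<longlonglongrightarrow> 0"
    by (rule power_p_fact_tendsto_1)
  \<comment> \<open>Pulling out \<open>?u ^ k\<close>, of absolute value 1, identifies the distance
    between the two sequences defining \<open>teich\<close> with one that tends to 0.\<close>
  have "dist (?u' ^ k) (?u ^ k) = pabs (z ^ k - 1)" for k
  proof -
    have "?u' ^ k - ?u ^ k = ?u ^ k * (z ^ k - 1)"
      by (simp add: u' power_mult_distrib algebra_simps)
    then show ?thesis by (simp add: dist_eq_pabs pabs_mult pabs_power u)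
  qed
  then have "teich p ppow (l + x) = teich p ppow l"
    unfolding teich_def using lim by (intro lim_eqI_dist) simp
  then show ?thesis by (simp add: omega_v_def val)
qed

end

section \<open>Local analyticity of the integrand and passage to the integral\<close>

lemma power_in_loc_an:
  assumes "\<And>z. z \<in> nbhd \<sigma> 1 \<Longrightarrow> pabs (z::'a) \<le> B"
  shows "(\<lambda>x. (l + x) ^ m) \<in> loc_an \<sigma>"
proof -
  \<comment> \<open>Expansion of \<open>((z - a) + (l + a)) ^ m\<close> about \<open>a\<close>. For
    \<open>n > m\<close> the truncated exponent \<open>m - n\<close> is harmless, as
    \<open>m choose n\<close> is 0.\<close>
  have "(\<lambda>n. of_nat (m choose n) * (l + a) ^ (m - n) * (z - a) ^ n) sums (l + z) ^ m" for a z
  proof -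
    have "(\<Sum>n\<le>m. of_nat (m choose n) * (l + a) ^ (m - n) * (z - a) ^ n) = ((z - a) + (l + a)) ^ m"
      unfolding binomial_ring by (simp add: mult_ac)
    then show ?thesis
      using sums_finite[of "{..m}" "\<lambda>n. of_nat (m choose n) * (l + a) ^ (m - n) * (z - a) ^ n"]
      by (simp add: add.commute)
  qed
  then have "\<exists>c. \<forall>z\<in>ball a 1. (\<lambda>n. c n * (z - a) ^ n) sums (l + z) ^ m" for a
    by (intro exI[of _ "\<lambda>n. of_nat (m choose n) * (l + a) ^ (m - n)"]) simp
  moreover have "pabs ((l + z) ^ m) \<le> max (pabs l) B ^ m" if "z \<in> nbhd \<sigma> 1" for z
    unfolding pabs_power
    using pabs_add_le_max[of l z] assms[OF that] by (intro power_mono) (auto simp: pabs_nonneg)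
  ultimately have "(\<lambda>x. (l + x) ^ m) \<in> LA_space \<sigma> 1"
    by (auto simp: LA_space_def intro!: bdd_aboveI)
  then show ?thesis unfolding loc_an_def by (intro UN_I[of 1]) auto
qed

text \<open>The bound \<open>B\<close> is taken on a whole neighbourhood of \<open>\<sigma>\<close>
  because equality of germs requires agreement there, not just on \<open>\<sigma>\<close>.\<close>

lemma zeta_E_at_one_minus_nat:
  assumes "fractional_powers p ppow" "\<nu> \<in> L_dual \<sigma>"
    and B: "\<And>z. z \<in> nbhd \<sigma> 1 \<Longrightarrow> pabs (z::'a) \<le> B" and l: "pabs l > B"
  shows "zeta_E p ppow \<sigma> \<nu> (1 - of_nat m) l
           = 1 / omega_v p ppow l ^ m * Euler_E \<sigma> \<nu> m l"
proof -
  have "angle_pow p ppow (l + x) (of_nat m) = 1 / omega_v p ppow l ^ m * (l + x) ^ m"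
    if "x \<in> nbhd \<sigma> 1" for x
  proof -
    have "pabs x < pabs l" using B[OF that] l by linarith
    then show ?thesis
      by (simp add: angle_pow_of_nat angle_def omega_v_add[OF assms(1)] power_divide)
  qed
  then have "germ \<sigma> (\<lambda>x. angle_pow p ppow (l + x) (of_nat m))
      = germ \<sigma> (\<lambda>x. 1 / omega_v p ppow l ^ m * (l + x) ^ m)"
    by (intro germ_cong[of 1]) simp_all
  \<comment> \<open>Homogeneity of \<open>\<nu>\<close> is available only for locally analytic
    functions, hence the appeal to \<open>power_in_loc_an\<close>.\<close>
  moreover have "\<nu> (germ \<sigma> (\<lambda>x. c * (l + x) ^ m)) = c * \<nu> (germ \<sigma> (\<lambda>x. (l + x) ^ m))" for c
    using assms(2) power_in_loc_an[OF B] by (simp add: L_dual_def)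
  ultimately show ?thesis
    by (simp only: zeta_E_def Euler_E_def integral_L_def diff_diff_eq2 add_diff_cancel_left')
qed

lemma bounded_nbhd:
  assumes "compact (\<sigma> :: 'a set)"
  obtains B where "\<And>z. z \<in> nbhd \<sigma> 1 \<Longrightarrow> pabs z \<le> B"
proof -
  obtain e where e: "\<And>y. y \<in> \<sigma> \<Longrightarrow> dist 0 y \<le> e"
    using compact_imp_bounded[OF assms] by (auto simp: bounded_any_center[of _ 0])
  have "pabs z \<le> e + 1" if z: "z \<in> nbhd \<sigma> 1" for z
  proof -
    obtain a where a: "a \<in> \<sigma>" "dist a z < 1" using z by (auto simp: nbhd_def)
    then show ?thesis
      using e[OF a(1)] dist_triangle[of 0 z a] by (simp add: pabs_def dist_commute)
  qed
  then show ?thesis using that by blast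
qed

end

theorem theorem3p14:
  fixes p :: nat
    and ppow :: "rat \<Rightarrow> 'a::{field_char_0,complete_space}"
    and \<sigma> :: "'a set"
    and \<nu> :: "('a \<Rightarrow> 'a) set \<Rightarrow> 'a"
  assumes "padic_complex_field TYPE('a) p"
    and "odd p"
    and "fractional_powers p ppow"
    and "compact \<sigma>"
    and "\<nu> \<in> L_dual \<sigma>"
  shows "\<exists>R. \<forall>(m::nat) l. pabs l > R \<longrightarrow>
           zeta_E p ppow \<sigma> \<nu> (1 - of_nat m) l
             = 1 / omega_v p ppow l ^ m * Euler_E \<sigma> \<nu> m l"
proof -
  \<comment> \<open>\<open>B\<close> depends on \<open>\<sigma>\<close> alone, so as
    \<open>R\<close> it serves all \<open>m\<close> at once.\<close>
  obtain B where "\<And>z. z \<in> nbhd \<sigma> 1 \<Longrightarrow> pabs z \<le> B"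
    using padic_complex_field.bounded_nbhd[OF assms(1,4)] by blast
  then show ?thesis
    using padic_complex_field.zeta_E_at_one_minus_nat[OF assms(1,3,5)] by blast
qed

end
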